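(* Let $$z=\sum_{1\le i<j<k<l\le n}\xi_{ijkl},$$ where $\xi_{ijkl}\in H_{ijkl}$ are arbitrary elements, that is, $\xi_{ijkl}=w_{ijkl}\,\eta_{ijkl}+w_{iklj}\,\eta_{iklj}$ for some $w_{ijkl},w_{iklj}\in\mathbb{C}$. Let $\chi_z^{\mathbb{C}^n}(t)=\det(t\,\mathrm{Id}-z)$ be the characteristic polynomial of $z$ acting in the permutation representation $\mathbb{C}^n$ of $S_n$. Then $$\chi_z^{\mathbb{C}^n}(t)=t^n+\mu_1t^{n-1}+\dots+\mu_{n-1}t,$$ where $$\mu_r=\Phi_r(z^{\otimes r})$$ for every $r=1,\dots,n-1$.
   Context: The permutation group $S_n$ acts on $\mathbb{C}^n$ by permuting coordinates, and the action is extended linearly to the group algebra $\mathbb{C}[S_n]$. The notation $(i_1\dots i_k)$ means the cyclic permutation $i_1\mapsto i_2\mapsto\dots\mapsto i_k\mapsto i_1$ leaving all other elements fixed. For pairwise distinct $i,j,k,l\in\{1,\dots,n\}$ put $\eta_{ijkl}=(ijkl)+(ilkj)-(ijlk)-(iklj)\in\mathbb{C}[S_n]$. For $1\le i<j<k<l\le n$, $H_{ijkl}\subset\mathbb{C}[S_n]$ is the vector space spanned by all $\eta_{pqrs}$ with $(p,q,r,s)$ a permutation of $(i,j,k,l)$; it has dimension 2 and basis $\{\eta_{ijkl},\eta_{iklj}\}$. Shuffle determinant: for $n\times n$ matrices $A=(a_{ij})$, $B=(b_{ij})$ (of any size $n$) and $I\subseteq\{1,\dots,n\}$, the $I$-shuffle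 is the $n\times n$ matrix $(A,B)_I=(u_{ij})$ with $u_{ij}=a_{ij}$ if $i\in I$ and $u_{ij}=b_{ij}$ if $i\notin I$. The shuffle determinant is $$\mathrm{sdet}(A,B)=\sum_{I\subseteq\{1,\dots,n\}}\det(A,B)_I\,\det(A,B)_{\bar I},\qquad \bar I=\{1,\dots,n\}\setminus I.$$ The functional $\Phi_r$: let $\mathcal{E}$ be an $r$-element set whose elements are 4-tuples $(i_1,j_1,k_1,l_1),\dots,(i_r,j_r,k_r,l_r)$; here $1\le r\le n$. Let $H_{\mathcal E}=\bigotimes_{s=1}^r H_{i_sj_sk_sl_s}$, a vector space of dimension $2^r$. Let $A_{\mathcal E},B_{\mathcal E}$ be the $r\times n$ matrices with $(A_{\mathcal E})_{s i_s}=1$, $(A_{\mathcal E})_{s j_s}=-1$, $(B_{\mathcal E})_{s k_s}=1$, $(B_{\mathcal E})_{s l_s}=-1$ for $s=1,\dots,r$, and all other entries $0$. For an $r$-element set $J\subseteq\{1,\dots,n\}$ let $A_{\mathcal E}^J,B_{\mathcal E}^J$ be the $r\times r$ submatrices of $A_{\mathcal E},B_{\mathcal E}$ containing all $r$ rows and the columns listed in $J$. The linear functional $\Phi_r:H_{\mathcal E}\to\mathbb{C}$ is defined by $$\Phi_r(\eta_{i_1j_1k_1l_1}\otimes\dots\otimes\eta_{i_rj_rk_rl_r})=\sum_{J\subseteq\{1,\dots,n\},\ \#J=r}\mathrm{sdet}(A_{\mathcal E}^J,B_{\mathcal E}^J)$$ and extended to the whole of $H_{\mathcal E}$ by linearity.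 In $\Phi_r(z^{\otimes r})$ the tensor power $z^{\otimes r}$ is expanded by linearity into tensor products of elements of the spaces $H_{ijkl}$, and $\Phi_r$ is applied term by term.
   Formalization: The formula is corrected to μ_r = Φ_r(z^{⊗r})/r!; as printed it fails for r ≥ 2: with n = 4 and z = η_{1234} one has μ_2 = −4 but Φ_2(z⊗z) = −8. Φ_r is taken on all ordered r-tuples of 4-tuples, repetitions allowed, as the expansion of z^{⊗r} requires. *)

theory Defs
  imports
    "Jordan_Normal_Form.Char_Poly"
    "Jordan_Normal_Form.DL_Submatrix"
    "HOL-Combinatorics.Cycles"
    "HOL-Library.Function_Algebras"
begin

text \<open>
  Indices run over \<open>{..<n}\<close> instead of \<open>{1..n}\<close>. Elements of the group algebra
  are complex-valued functions on permutations; elements of its \<open>r\<close>-th tensor power are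
  complex-valued functions on lists of \<open>r\<close> permutations. Both carry the pointwise
  vector space structure.
\<close>

type_synonym grp_alg = "(nat \<Rightarrow> nat) \<Rightarrow> complex"

type_synonym tensor = "(nat \<Rightarrow> nat) list \<Rightarrow> complex"

definition cscale :: "complex \<Rightarrow> ('a \<Rightarrow> complex) \<Rightarrow> ('a \<Rightarrow> complex)" (infixr "*\<^sub>c" 75) where
  "c *\<^sub>c f = (\<lambda>x. c * f x)"

interpretation cfun: vector_space "cscale :: complex \<Rightarrow> ('a \<Rightarrow> complex) \<Rightarrow> 'a \<Rightarrow> complex"
  by unfold_locales (auto simp: cscale_def fun_eq_iff algebra_simps)

definition of_perm :: "(nat \<Rightarrow> nat) \<Rightarrow> grp_alg" where
  "of_perm p = (\<lambda>q. if q = p then 1 else 0)"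

definition perm_mat :: "nat \<Rightarrow> (nat \<Rightarrow> nat) \<Rightarrow> complex mat" where
  "perm_mat n p = mat n n (\<lambda>(a, b). if a = p b then 1 else 0)"

definition rep_mat :: "nat \<Rightarrow> grp_alg \<Rightarrow> complex mat" where
  "rep_mat n x = mat n n (\<lambda>(a, b). \<Sum>p | p permutes {..<n}. x p * perm_mat n p $$ (a, b))"

definition eta :: "nat \<Rightarrow> nat \<Rightarrow> nat \<Rightarrow> nat \<Rightarrow> grp_alg" where
  "eta i j k l = of_perm (cycle_of_list [i, j, k, l]) + of_perm (cycle_of_list [i, l, k, j])
               - of_perm (cycle_of_list [i, j, l, k]) - of_perm (cycle_of_list [i, k, l, j])"

definition H_space :: "nat \<Rightarrow> nat \<Rightarrow> nat \<Rightarrow> nat \<Rightarrow> grp_alg set" where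
  "H_space i j k l =
     cfun.span {eta p q r s |p q r s. distinct [p, q, r, s] \<and> {p, q, r, s} = {i, j, k, l}}"

definition shuffle :: "complex mat \<Rightarrow> complex mat \<Rightarrow> nat set \<Rightarrow> complex mat" where
  "shuffle A B I = mat (dim_row A) (dim_col A) (\<lambda>(i, j). if i \<in> I then A $$ (i, j) else B $$ (i, j))"

definition sdet :: "complex mat \<Rightarrow> complex mat \<Rightarrow> complex" where
  "sdet A B = (\<Sum>I\<in>Pow {..<dim_row A}. det (shuffle A B I) * det (shuffle A B ({..<dim_row A} - I)))"

type_synonym quad = "nat \<times> nat \<times> nat \<times> nat"

definition quads :: "nat \<Rightarrow> quad set" where
  "quads n = {(i, j, k, l). distinct [i, j, k, l] \<and> {i, j, k, l} \<subseteq> {..<n}}"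

definition A_mat :: "nat \<Rightarrow> quad list \<Rightarrow> complex mat" where
  "A_mat n E = mat (length E) n
     (\<lambda>(s, c). case E ! s of (i, j, k, l) \<Rightarrow> if c = i then 1 else if c = j then -1 else 0)"

definition B_mat :: "nat \<Rightarrow> quad list \<Rightarrow> complex mat" where
  "B_mat n E = mat (length E) n
     (\<lambda>(s, c). case E ! s of (i, j, k, l) \<Rightarrow> if c = k then 1 else if c = l then -1 else 0)"

definition tensor :: "grp_alg list \<Rightarrow> tensor" where
  "tensor xs = (\<lambda>gs. if length gs = length xs then \<Prod>s<length xs. (xs ! s) (gs ! s) else 0)"

abbreviation tensor_power :: "nat \<Rightarrow> grp_alg \<Rightarrow> tensor" where
  "tensor_power r x \<equiv> tensor (replicate r x)"

abbreviation eta_tensor :: "quad list \<Rightarrow> tensor" where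
  "eta_tensor E \<equiv> tensor (map (\<lambda>(i, j, k, l). eta i j k l) E)"

text \<open>The sum, inside the tensor power of the group algebra, of the spaces \<open>H\<^sub>E\<close> over all \<open>E\<close>.
  The expansion of a tensor power contains products with repeated factors, so \<open>E\<close> is a list
  of quadruples, possibly with repetitions.\<close>

definition H_tensor :: "nat \<Rightarrow> nat \<Rightarrow> tensor set" where
  "H_tensor n r = cfun.span {eta_tensor E |E. length E = r \<and> set E \<subseteq> quads n}"

definition is_Phi :: "nat \<Rightarrow> nat \<Rightarrow> (tensor \<Rightarrow> complex) \<Rightarrow> bool" where
  "is_Phi n r F \<longleftrightarrow>
     (\<forall>x\<in>H_tensor n r. \<forall>y\<in>H_tensor n r. F (x + y) = F x + F y) \<and>
     (\<forall>c. \<forall>x\<in>H_tensor n r. F (c *\<^sub>c x) = c * F x) \<and>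
     (\<forall>E. length E = r \<and> set E \<subseteq> quads n \<longrightarrow>
        F (eta_tensor E) =
          (\<Sum>J | J \<subseteq> {..<n} \<and> card J = r.
             sdet (submatrix (A_mat n E) UNIV J) (submatrix (B_mat n E) UNIV J)))"

text \<open>Existence, and uniqueness on \<open>H_tensor n r\<close>, are \<open>ex_Phi\<close> and \<open>Phi_unique\<close> below.\<close>

definition Phi :: "nat \<Rightarrow> nat \<Rightarrow> tensor \<Rightarrow> complex" where
  "Phi n r = (SOME F. is_Phi n r F)"

lemma eta_tensor_in: "length E = r \<Longrightarrow> set E \<subseteq> quads n \<Longrightarrow> eta_tensor E \<in> H_tensor n r"
  unfolding H_tensor_def by (rule cfun.span_base) blast

lemma Phi_unique:
  assumes "is_Phi n r F" "is_Phi n r G" "x \<in> H_tensor n r"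
  shows "F x = G x"
proof -
  have z: "F 0 = 0" "G 0 = 0"
    using assms(1,2) cfun.span_zero[of "{eta_tensor E |E. length E = r \<and> set E \<subseteq> quads n}"]
    unfolding is_Phi_def H_tensor_def[symmetric] by (metis cfun.scale_zero_left mult_zero_left)+
  have "x \<in> cfun.span {eta_tensor E |E. length E = r \<and> set E \<subseteq> quads n}"
    using assms(3) by (simp add: H_tensor_def)
  then have "x \<in> H_tensor n r \<and> F x = G x"
  proof (induction rule: cfun.span_induct_alt)
    case base
    show ?case unfolding H_tensor_def using z by (auto intro: cfun.span_zero simp del: zero_fun_apply)
  next
    case (step c x y)
    then obtain E where E: "x = eta_tensor E" "length E = r" "set E \<subseteq> quads n" by blast
    have x: "x \<in> H_tensor n r" using E eta_tensor_in by blast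
    have cx: "c *\<^sub>c x \<in> H_tensor n r"
      using x unfolding H_tensor_def by (rule cfun.span_scale)
    have y: "y \<in> H_tensor n r" "F y = G y" using step by auto
    have lin: "K (c *\<^sub>c x + y) = c * K x + K y" if "is_Phi n r K" for K
      using that x cx y(1) unfolding is_Phi_def by simp
    have "F x = G x" using assms(1,2) E unfolding is_Phi_def by simp
    then have "F (c *\<^sub>c x + y) = G (c *\<^sub>c x + y)"
      unfolding lin[OF assms(1)] lin[OF assms(2)] using y(2) by simp
    moreover have "c *\<^sub>c x + y \<in> H_tensor n r"
      using cx y(1) unfolding H_tensor_def by (rule cfun.span_add)
    ultimately show ?case by (rule conjI[rotated])
  qed
  then show ?thesis by simp
qed

lemma cycle4:
  assumes "distinct [i, j, k, l]"
  shows "cycle_of_list [i, j, k, l] = (\<lambda>x. if x = i then j else if x = j then k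
           else if x = k then l else if x = l then i else x)"
  using assms by (auto simp: fun_eq_iff transpose_def)

lemma rep_mat_of_perm_sum:
  assumes "p permutes {..<n}" "a < n" "b < n"
  shows "(\<Sum>q | q permutes {..<n}. of_perm p q * perm_mat n q $$ (a, b)) = (if a = p b then 1 else 0)"
proof -
  have "(\<Sum>q | q permutes {..<n}. of_perm p q * perm_mat n q $$ (a, b))
      = (\<Sum>q | q permutes {..<n}. if q = p then perm_mat n q $$ (a, b) else 0)"
    by (rule sum.cong) (auto simp: of_perm_def)
  also have "\<dots> = perm_mat n p $$ (a, b)"
    using assms by (simp add: sum.delta finite_permutations)
  finally show ?thesis using assms by (simp add: perm_mat_def)
qed

lemma rep_eta:
  assumes "(i, j, k, l) \<in> quads n" "a < n" "b < n"
  shows "(\<Sum>p | p permutes {..<n}. eta i j k l p * perm_mat n p $$ (a, b)) =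
    - ((if a = i then 1 else if a = j then -1 else 0) * (if b = k then 1 else if b = l then -1 else 0)
     + (if a = k then 1 else if a = l then -1 else 0) * (if b = i then 1 else if b = j then -1 else 0))"
proof -
  have d: "distinct [i, j, k, l]" and s: "i < n" "j < n" "k < n" "l < n"
    using assms(1) by (auto simp: quads_def)
  have P: "cycle_of_list [p, q, r, t] permutes {..<n}"
    if "p < n" "q < n" "r < n" "t < n" for p q r t
    using that by (intro permutes_subset[OF cycle_permutes]) auto
  have ne: "i \<noteq> j" "i \<noteq> k" "i \<noteq> l" "j \<noteq> k" "j \<noteq> l" "k \<noteq> l"
    "j \<noteq> i" "k \<noteq> i" "l \<noteq> i" "k \<noteq> j" "l \<noteq> j" "l \<noteq> k"
    using d by auto
  have d': "distinct [i, l, k, j]" "distinct [i, j, l, k]" "distinct [i, k, l, j]"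
    using d by auto
  have "(\<Sum>p | p permutes {..<n}. eta i j k l p * perm_mat n p $$ (a, b)) =
      (if a = cycle_of_list [i, j, k, l] b then 1 else 0) + (if a = cycle_of_list [i, l, k, j] b then 1 else 0)
    - (if a = cycle_of_list [i, j, l, k] b then 1 else 0) - (if a = cycle_of_list [i, k, l, j] b then 1 else 0)"
    unfolding eta_def plus_fun_def fun_diff_def
    unfolding distrib_right left_diff_distrib sum.distrib sum_subtractf
    using rep_mat_of_perm_sum[OF P assms(2,3)] s by (simp del: cycle_of_list.simps)
  also have "\<dots> =
    - ((if a = i then 1 else if a = j then -1 else 0) * (if b = k then 1 else if b = l then -1 else 0)
     + (if a = k then 1 else if a = l then -1 else 0) * (if b = i then 1 else if b = j then -1 else 0))"
    unfolding cycle4[OF d] cycle4[OF d'(1)] cycle4[OF d'(2)] cycle4[OF d'(3)]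
    by (cases "b = i"; cases "b = j"; cases "b = k"; cases "b = l") (simp_all add: ne)
  finally show ?thesis .
qed

lemma sum_lists_prod:
  fixes xs :: "('a \<Rightarrow> complex) list"
  assumes "finite G"
  shows "(\<Sum>gs | set gs \<subseteq> G \<and> length gs = length xs. \<Prod>s<length xs. (xs ! s) (gs ! s) * f s (gs ! s))
       = (\<Prod>s<length xs. \<Sum>g\<in>G. (xs ! s) g * f s g)"
proof (induction xs arbitrary: f)
  case Nil
  have "{gs. set gs \<subseteq> G \<and> length gs = length ([]::('a \<Rightarrow> complex) list)} = {[]}" by auto
  then show ?case by simp
next
  case (Cons x xs)
  let ?L = "\<lambda>m. {gs. set gs \<subseteq> G \<and> length gs = m}"
  have L: "?L (length (x # xs)) = (\<lambda>(g, gs). g # gs) ` (G \<times> ?L (length xs))"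
    by (auto simp: image_iff length_Suc_conv)
  have "(\<Sum>gs\<in>?L (length (x # xs)). \<Prod>s<length (x # xs). ((x # xs) ! s) (gs ! s) * f s (gs ! s))
      = (\<Sum>(g, gs)\<in>G \<times> ?L (length xs). (x g * f 0 g) *
           (\<Prod>s<length xs. (xs ! s) (gs ! s) * f (Suc s) (gs ! s)))"
    unfolding L
    by (subst sum.reindex) (auto simp: inj_on_def prod.lessThan_Suc_shift intro!: sum.cong simp del: prod.lessThan_Suc)
  also have "\<dots> = (\<Sum>g\<in>G. x g * f 0 g) *
      (\<Sum>gs\<in>?L (length xs). \<Prod>s<length xs. (xs ! s) (gs ! s) * f (Suc s) (gs ! s))"
    by (simp add: sum.cartesian_product[symmetric] sum_product)
  also have "\<dots> = (\<Sum>g\<in>G. x g * f 0 g) * (\<Prod>s<length xs. \<Sum>g\<in>G. (xs ! s) g * f (Suc s) g)"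
    by (simp only: Cons.IH[of "\<lambda>s. f (Suc s)"])
  finally show ?case by (simp add: prod.lessThan_Suc_shift del: prod.lessThan_Suc)
qed

lemma sdet_expand:
  assumes A: "A \<in> carrier_mat r r" and B: "B \<in> carrier_mat r r"
  shows "sdet A B = (\<Sum>\<sigma> | \<sigma> permutes {..<r}. \<Sum>\<tau> | \<tau> permutes {..<r}.
    signof \<sigma> * signof \<tau> * (\<Prod>s<r. A $$ (s, \<sigma> s) * B $$ (s, \<tau> s) + B $$ (s, \<sigma> s) * A $$ (s, \<tau> s)))"
proof -
  have permutes_less: "\<sigma> s < r" if "\<sigma> permutes {..<r}" "s < r" for \<sigma> s
    using that permutes_in_image[of \<sigma> "{..<r}" s] by simp
  let ?P = "{\<sigma>. \<sigma> permutes {..<r}}"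
  let ?u = "\<lambda>I s c. if s \<in> I then A $$ (s, c) else B $$ (s, c)"
  have dS: "det (shuffle A B I) = (\<Sum>\<sigma>\<in>?P. signof \<sigma> * (\<Prod>s<r. ?u I s (\<sigma> s)))" for I
  proof -
    have c: "shuffle A B I \<in> carrier_mat r r" using A by (auto simp: shuffle_def)
    show ?thesis
      unfolding det_def'[OF c] atLeast0LessThan
      using A by (intro sum.cong refl arg_cong2[where f = "(*)"] prod.cong)
        (auto simp: shuffle_def permutes_less)
  qed
  have split: "(\<Sum>I\<in>Pow {..<r}. (\<Prod>s<r. ?u I s (\<sigma> s)) * (\<Prod>s<r. ?u ({..<r} - I) s (\<tau> s)))
     = (\<Prod>s<r. A $$ (s, \<sigma> s) * B $$ (s, \<tau> s) + B $$ (s, \<sigma> s) * A $$ (s, \<tau> s))" for \<sigma> \<tau>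
  proof -
    have "(\<Prod>s<r. ?u I s (\<sigma> s)) * (\<Prod>s<r. ?u ({..<r} - I) s (\<tau> s))
       = (\<Prod>s\<in>I. A $$ (s, \<sigma> s) * B $$ (s, \<tau> s)) * (\<Prod>s\<in>{..<r} - I. B $$ (s, \<sigma> s) * A $$ (s, \<tau> s))"
      if "I \<in> Pow {..<r}" for I
    proof -
      have "(\<Prod>s<r. ?u I s (\<sigma> s)) * (\<Prod>s<r. ?u ({..<r} - I) s (\<tau> s))
          = (\<Prod>s<r. ?u I s (\<sigma> s) * ?u ({..<r} - I) s (\<tau> s))"
        by (simp add: prod.distrib)
      also have "\<dots> = (\<Prod>s\<in>{..<r} - I. ?u I s (\<sigma> s) * ?u ({..<r} - I) s (\<tau> s))
                    * (\<Prod>s\<in>I. ?u I s (\<sigma> s) * ?u ({..<r} - I) s (\<tau> s))"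
        using that by (intro prod.subset_diff) auto
      also have "(\<Prod>s\<in>{..<r} - I. ?u I s (\<sigma> s) * ?u ({..<r} - I) s (\<tau> s))
          = (\<Prod>s\<in>{..<r} - I. B $$ (s, \<sigma> s) * A $$ (s, \<tau> s))"
        by (rule prod.cong) auto
      also have "(\<Prod>s\<in>I. ?u I s (\<sigma> s) * ?u ({..<r} - I) s (\<tau> s))
          = (\<Prod>s\<in>I. A $$ (s, \<sigma> s) * B $$ (s, \<tau> s))"
        by (rule prod.cong) auto
      finally show ?thesis by (simp only: mult.commute)
    qed
    then show ?thesis by (simp add: prod_add)
  qed
  have "sdet A B = (\<Sum>I\<in>Pow {..<r}. \<Sum>\<sigma>\<in>?P. \<Sum>\<tau>\<in>?P. signof \<sigma> * signof \<tau> *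
      ((\<Prod>s<r. ?u I s (\<sigma> s)) * (\<Prod>s<r. ?u ({..<r} - I) s (\<tau> s))))"
    using A unfolding sdet_def
    by (auto simp: dS sum_product mult_ac intro!: sum.cong)
  also have "\<dots> = (\<Sum>\<sigma>\<in>?P. \<Sum>\<tau>\<in>?P. \<Sum>I\<in>Pow {..<r}. signof \<sigma> * signof \<tau> *
      ((\<Prod>s<r. ?u I s (\<sigma> s)) * (\<Prod>s<r. ?u ({..<r} - I) s (\<tau> s))))"
    by (subst sum.swap) (intro sum.cong refl sum.swap)
  finally show ?thesis
    by (simp only: sum_distrib_left[symmetric] split)
qed

text \<open>An explicit formula for the functional, on the whole tensor power.\<close>

definition Phi0 :: "nat \<Rightarrow> nat \<Rightarrow> tensor \<Rightarrow> complex" where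
  "Phi0 n r T = (\<Sum>J | J \<subseteq> {..<n} \<and> card J = r.
     \<Sum>\<sigma> | \<sigma> permutes {..<r}. \<Sum>\<tau> | \<tau> permutes {..<r}. signof \<sigma> * signof \<tau> *
       (\<Sum>gs | set gs \<subseteq> {p. p permutes {..<n}} \<and> length gs = r.
          T gs * (\<Prod>s<r. - perm_mat n (gs ! s) $$ (pick J (\<sigma> s), pick J (\<tau> s)))))"

lemma Phi0_eta:
  assumes len: "length E = r" and E: "set E \<subseteq> quads n"
  shows "Phi0 n r (eta_tensor E) = (\<Sum>J | J \<subseteq> {..<n} \<and> card J = r.
             sdet (submatrix (A_mat n E) UNIV J) (submatrix (B_mat n E) UNIV J))"
  unfolding Phi0_def
proof (rule sum.cong[OF refl], clarify)
  fix J assume J: "J \<subseteq> {..<n}" and r: "r = card J"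
  let ?A = "submatrix (A_mat n E) UNIV J" and ?B = "submatrix (B_mat n E) UNIV J"
  have Jn: "{j. j < n \<and> j \<in> J} = J" using J by auto
  have pn: "pick J x < n" if "x < r" for x
    using that J r pick_in_set_le by blast
  have cA: "?A \<in> carrier_mat r r" and cB: "?B \<in> carrier_mat r r"
    using len r by (auto simp: dim_submatrix A_mat_def B_mat_def Jn)
  have eA: "?A $$ (s, c) = A_mat n E $$ (s, pick J c)"
    and eB: "?B $$ (s, c) = B_mat n E $$ (s, pick J c)" if "s < r" "c < r" for s c
    using that len r by (simp_all add: submatrix_index pick_UNIV Jn A_mat_def B_mat_def)
  let ?xs = "map (\<lambda>(i, j, k, l). eta i j k l) E"
  have key: "(\<Sum>gs | set gs \<subseteq> {p. p permutes {..<n}} \<and> length gs = r.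
          eta_tensor E gs * (\<Prod>s<r. - perm_mat n (gs ! s) $$ (pick J (\<sigma> s), pick J (\<tau> s))))
      = (\<Prod>s<r. ?A $$ (s, \<sigma> s) * ?B $$ (s, \<tau> s) + ?B $$ (s, \<sigma> s) * ?A $$ (s, \<tau> s))"
    if \<sigma>: "\<sigma> permutes {..<r}" and \<tau>: "\<tau> permutes {..<r}" for \<sigma> \<tau>
  proof -
    let ?f = "\<lambda>s g. - perm_mat n g $$ (pick J (\<sigma> s), pick J (\<tau> s))"
    have "(\<Sum>gs | set gs \<subseteq> {p. p permutes {..<n}} \<and> length gs = r. eta_tensor E gs * (\<Prod>s<r. ?f s (gs ! s)))
        = (\<Sum>gs | set gs \<subseteq> {p. p permutes {..<n}} \<and> length gs = length ?xs.
             \<Prod>s<length ?xs. (?xs ! s) (gs ! s) * ?f s (gs ! s))"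
      using len by (intro sum.cong) (auto simp: tensor_def prod.distrib simp del: mult_minus_right)
    also have "\<dots> = (\<Prod>s<length ?xs. \<Sum>g | g permutes {..<n}. (?xs ! s) g * ?f s g)"
      by (rule sum_lists_prod) (simp add: finite_permutations)
    also have "\<dots> = (\<Prod>s<r. ?A $$ (s, \<sigma> s) * ?B $$ (s, \<tau> s) + ?B $$ (s, \<sigma> s) * ?A $$ (s, \<tau> s))"
    proof (rule prod.cong)
      fix s assume "s \<in> {..<r}"
      then have s: "s < r" "\<sigma> s < r" "\<tau> s < r"
        using permutes_in_image[OF \<sigma>, of s] permutes_in_image[OF \<tau>, of s] by simp_all
      obtain i j k l where q: "E ! s = (i, j, k, l)" by (metis prod_cases4)
      have Q: "(i, j, k, l) \<in> quads n" using q s len E nth_mem by fastforce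
      have "(\<Sum>g | g permutes {..<n}. (?xs ! s) g * ?f s g)
          = - (\<Sum>g | g permutes {..<n}. eta i j k l g * perm_mat n g $$ (pick J (\<sigma> s), pick J (\<tau> s)))"
        using s len q by (simp add: sum_negf)
      then show "(\<Sum>g | g permutes {..<n}. (?xs ! s) g * ?f s g)
          = ?A $$ (s, \<sigma> s) * ?B $$ (s, \<tau> s) + ?B $$ (s, \<sigma> s) * ?A $$ (s, \<tau> s)"
        unfolding rep_eta[OF Q pn[OF s(2)] pn[OF s(3)]]
        unfolding eA[OF s(1,2)] eB[OF s(1,3)] eA[OF s(1,3)] eB[OF s(1,2)]
        using s len q pn by (simp add: A_mat_def B_mat_def)
    qed (simp add: len)
    finally show ?thesis .
  qed
  show "(\<Sum>\<sigma> | \<sigma> permutes {..<card J}. \<Sum>\<tau> | \<tau> permutes {..<card J}. signof \<sigma> * signof \<tau> *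
       (\<Sum>gs | set gs \<subseteq> {p. p permutes {..<n}} \<and> length gs = card J.
          eta_tensor E gs * (\<Prod>s<card J. - perm_mat n (gs ! s) $$ (pick J (\<sigma> s), pick J (\<tau> s)))))
      = sdet ?A ?B"
    unfolding sdet_expand[OF cA cB] r[symmetric]
    by (intro sum.cong refl) (simp add: key)
qed

lemma is_Phi_Phi0: "is_Phi n r (Phi0 n r)"
  unfolding is_Phi_def
proof (intro conjI ballI allI impI)
  show "Phi0 n r (x + y) = Phi0 n r x + Phi0 n r y" for x y
    by (simp add: Phi0_def distrib_right distrib_left sum.distrib)
  show "Phi0 n r (c *\<^sub>c x) = c * Phi0 n r x" for c x
    by (simp add: Phi0_def cscale_def sum_distrib_left mult_ac)
qed (use Phi0_eta in blast)

lemma ex_Phi: "\<exists>F. is_Phi n r F"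
  using is_Phi_Phi0 by blast

lemma is_Phi_Phi: "is_Phi n r (Phi n r)"
  unfolding Phi_def using ex_Phi by (rule someI_ex)

lemma cycle4_rotate:
  assumes "distinct [i, j, k, l]"
  shows "cycle_of_list [j, k, l, i] = cycle_of_list [i, j, k, l]"
proof -
  have "distinct [j, k, l, i]" using assms by auto
  then show ?thesis
    unfolding cycle4[OF assms] cycle4[OF \<open>distinct [j, k, l, i]\<close>] using assms by (auto simp: fun_eq_iff)
qed

lemma eta_sym:
  assumes "distinct [i, j, k, l]"
  shows "eta j i k l = - eta i j k l" "eta i j l k = - eta i j k l" "eta k l i j = eta i j k l"
    "eta i l j k = - eta i j k l - eta i k l j"
proof -
  have d: "distinct [i, j, l, k]" "distinct [i, k, j, l]" "distinct [i, k, l, j]"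
    "distinct [i, l, j, k]" "distinct [i, l, k, j]"
    using assms by auto
  have R: "cycle_of_list [q, r, s, p] = cycle_of_list [p, q, r, s]"
    "cycle_of_list [r, s, p, q] = cycle_of_list [p, q, r, s]"
    "cycle_of_list [s, p, q, r] = cycle_of_list [p, q, r, s]"
    if "distinct [p, q, r, s]" for p q r s :: nat
  proof -
    have "distinct [q, r, s, p]" "distinct [r, s, p, q]" using that by auto
    note * = cycle4_rotate[OF that] cycle4_rotate[OF this(1)] cycle4_rotate[OF this(2)]
    show "cycle_of_list [q, r, s, p] = cycle_of_list [p, q, r, s]" by (rule *(1))
    show "cycle_of_list [r, s, p, q] = cycle_of_list [p, q, r, s]" by (rule trans[OF *(2,1)])
    show "cycle_of_list [s, p, q, r] = cycle_of_list [p, q, r, s]"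
      by (rule trans[OF *(3) trans[OF *(2,1)]])
  qed
  note R' = R[OF assms] R[OF d(1)] R[OF d(2)] R[OF d(3)] R[OF d(4)] R[OF d(5)]
  show "eta j i k l = - eta i j k l" "eta i j l k = - eta i j k l" "eta k l i j = eta i j k l"
    "eta i l j k = - eta i j k l - eta i k l j"
    unfolding eta_def R' by (simp_all add: fun_eq_iff algebra_simps del: cycle_of_list.simps)
qed

lemma eta_cases:
  assumes "distinct [p, q, r, s]" "{p, q, r, s} = {i, j, k, l}" "distinct [i, j, k, l]"
  shows "\<exists>v w. eta p q r s = v *\<^sub>c eta i j k l + w *\<^sub>c eta i k l j"
proof -
  define P where "P x \<longleftrightarrow> (\<exists>v w. x = v *\<^sub>c eta i j k l + w *\<^sub>c eta i k l j)" for x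
  have neg: "P (- x) \<longleftrightarrow> P x" for x
  proof -
    have "P (- x)" if Px: "P x" for x
    proof -
      obtain v w where "x = v *\<^sub>c eta i j k l + w *\<^sub>c eta i k l j" using Px unfolding P_def by blast
      then have "- x = (- v) *\<^sub>c eta i j k l + (- w) *\<^sub>c eta i k l j"
        by (simp add: fun_eq_iff cscale_def)
      then show ?thesis unfolding P_def by blast
    qed
    from this[of x] this[of "- x"] show ?thesis by auto
  qed
  have S: "P (eta b a c d) \<longleftrightarrow> P (eta a b c d)" "P (eta a b d c) \<longleftrightarrow> P (eta a b c d)"
    "P (eta c d a b) \<longleftrightarrow> P (eta a b c d)" if "distinct [a, b, c, d]" for a b c d
    unfolding eta_sym[OF that] neg by (rule refl)+
  have "eta i j k l = 1 *\<^sub>c eta i j k l + 0 *\<^sub>c eta i k l j"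
    "eta i k l j = 0 *\<^sub>c eta i j k l + 1 *\<^sub>c eta i k l j"
    "eta i l j k = (-1) *\<^sub>c eta i j k l + (-1) *\<^sub>c eta i k l j"
    unfolding eta_sym(4)[OF assms(3)] by (simp_all add: fun_eq_iff cscale_def)
  then have B: "P (eta i j k l)" "P (eta i k l j)" "P (eta i l j k)"
    unfolding P_def by blast+
  have C: "P (eta a b c d)" "P (eta b a c d)" "P (eta a b d c)" "P (eta b a d c)"
    "P (eta c d a b)" "P (eta c d b a)" "P (eta d c a b)" "P (eta d c b a)"
    if "P (eta a b c d)" "distinct [a, b, c, d]" for a b c d
  proof -
    have d: "distinct [b, a, c, d]" "distinct [a, b, d, c]" "distinct [b, a, d, c]" using that(2) by auto
    show "P (eta a b c d)" by (rule that(1))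
    show 1: "P (eta b a c d)" "P (eta a b d c)" "P (eta c d a b)" using S[OF that(2)] that(1) by blast+
    show 2: "P (eta b a d c)" "P (eta c d b a)" using S[OF d(1)] 1 by blast+
    show "P (eta d c a b)" using S[OF d(2)] 1 by blast
    show "P (eta d c b a)" using S[OF d(3)] 2 by blast
  qed
  have d: "distinct [i, k, l, j]" "distinct [i, l, j, k]" using assms(3) by auto
  have pm: "p \<in> {i, j, k, l}" "q \<in> {i, j, k, l}" "r \<in> {i, j, k, l}" "s \<in> {i, j, k, l}"
    using assms(2) by blast+
  have ne: "i \<noteq> j" "i \<noteq> k" "i \<noteq> l" "j \<noteq> k" "j \<noteq> l" "k \<noteq> l"
    "j \<noteq> i" "k \<noteq> i" "l \<noteq> i" "k \<noteq> j" "l \<noteq> j" "l \<noteq> k"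
    using assms(3) by auto
  have "\<forall>p\<in>{i, j, k, l}. \<forall>q\<in>{i, j, k, l}. \<forall>r\<in>{i, j, k, l}. \<forall>s\<in>{i, j, k, l}.
      distinct [p, q, r, s] \<longrightarrow> P (eta p q r s)"
    by (simp add: ne C[OF B(1) assms(3)] C[OF B(2) d(1)] C[OF B(3) d(2)])
  then have "P (eta p q r s)" using pm assms(1) by (simp only: Ball_def)
  then show ?thesis unfolding P_def .
qed

lemma H_space_eq:
  assumes "distinct [i, j, k, l]"
  shows "H_space i j k l = {v *\<^sub>c eta i j k l + w *\<^sub>c eta i k l j |v w. True}"
proof -
  let ?S = "{eta p q r s |p q r s. distinct [p, q, r, s] \<and> {p, q, r, s} = {i, j, k, l}}"
  have "?S \<subseteq> cfun.span {eta i j k l, eta i k l j}"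
  proof
    fix x assume "x \<in> ?S"
    then obtain v w where "x = v *\<^sub>c eta i j k l + w *\<^sub>c eta i k l j"
      using eta_cases[OF _ _ assms] by blast
    then show "x \<in> cfun.span {eta i j k l, eta i k l j}"
      by (simp only:) (intro cfun.span_add cfun.span_scale cfun.span_base; simp)
  qed
  moreover
  have "{eta i j k l, eta i k l j} \<subseteq> ?S"
  proof -
    have "distinct [i, k, l, j]" "{i, k, l, j} = {i, j, k, l}" using assms by auto
    then show ?thesis using assms by blast
  qed
  then have "{eta i j k l, eta i k l j} \<subseteq> cfun.span ?S"
    using cfun.span_superset by (rule subset_trans)
  ultimately have "H_space i j k l = cfun.span {eta i j k l, eta i k l j}"
    unfolding H_space_def
    by (intro subset_antisym cfun.span_minimal cfun.subspace_span)
  also have "\<dots> = {v *\<^sub>c eta i j k l + w *\<^sub>c eta i k l j |v w. True}"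
  proof (intro subset_antisym subsetI)
    fix x assume "x \<in> cfun.span {eta i j k l, eta i k l j}"
    then obtain v w where "x - v *\<^sub>c eta i j k l = w *\<^sub>c eta i k l j"
      unfolding cfun.span_insert[of "eta i j k l"] cfun.span_singleton by blast
    then have "x = v *\<^sub>c eta i j k l + w *\<^sub>c eta i k l j"
      by (metis add.commute diff_add_cancel)
    then show "x \<in> {v *\<^sub>c eta i j k l + w *\<^sub>c eta i k l j |v w. True}" by blast
  next
    fix x assume "x \<in> {v *\<^sub>c eta i j k l + w *\<^sub>c eta i k l j |v w. True}"
    then obtain v w where x: "x = v *\<^sub>c eta i j k l + w *\<^sub>c eta i k l j" by blast
    show "x \<in> cfun.span {eta i j k l, eta i k l j}"
      unfolding x by (intro cfun.span_add cfun.span_scale cfun.span_base; simp)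
  qed
  finally show ?thesis .
qed

text \<open>
  Expanding \<open>tensor_power r z\<close> produces every ordering of the factors, so each unordered
  collection of \<open>r\<close> quadruples is counted \<open>r!\<close> times, and the coefficient of the
  characteristic polynomial is the value of the functional divided by \<open>r!\<close>. The facts below show,
  for \<open>n = 4\<close> and a single \<open>eta\<close>, that this factor cannot be dropped.
\<close>

lemma pick_pair:
  fixes a b :: nat
  assumes "a < b"
  shows "pick {a, b} 0 = a" "pick {a, b} (Suc 0) = b"
proof -
  show 0: "pick {a, b} 0 = a"
    using assms by (auto intro!: Least_equality)
  show "pick {a, b} (Suc 0) = b"
    unfolding pick.simps(2) 0 using assms by (auto intro!: Least_equality)
qed

lemma permutes_2: "{\<sigma>. \<sigma> permutes {..<2::nat}} = {id, transpose 0 1}"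
proof -
  have "{..<2::nat} = {0, 1}" by auto
  then show ?thesis by (simp only: permutes_doubleton_iff) auto
qed

lemma Phi_square_eta: "Phi 4 2 (tensor_power 2 (eta 0 1 2 3)) = -8"
proof -
  define E where "E = ([(0, 1, 2, 3), (0, 1, 2, 3)] :: quad list)"
  have pairs: "{J. J \<subseteq> {..<4::nat} \<and> card J = 2} = {{0,1}, {0,2}, {0,3}, {1,2}, {1,3}, {2,3}}"
  proof -
    have "J \<in> {{0,1}, {0,2}, {0,3}, {1,2}, {1,3}, {2,3}}" if "J \<subseteq> {..<4::nat}" "card J = 2" for J
    proof -
      obtain a b where J: "J = {a, b}" "a \<noteq> b" using \<open>card J = 2\<close> card_2_iff by metis
      have "a \<in> {0,1,2,3}" "b \<in> {0,1,2,3}" using that J by auto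
      then show ?thesis using J by (elim insertE emptyE; simp add: insert_commute)
    qed
    moreover have "\<forall>J\<in>{{0,1}, {0,2}, {0,3}, {1,2}, {1,3}, {2,3}}. J \<subseteq> {..<4::nat} \<and> card J = 2"
      by simp
    ultimately show ?thesis
      by (intro subset_antisym subsetI) (simp_all only: mem_Collect_eq Ball_def)
  qed
  have sd: "sdet (submatrix (A_mat 4 E) UNIV {a, b}) (submatrix (B_mat 4 E) UNIV {a, b})
      = - 2 * (A_mat 4 E $$ (0, a) * B_mat 4 E $$ (0, b) - A_mat 4 E $$ (0, b) * B_mat 4 E $$ (0, a))\<^sup>2"
    if "a < b" "b < 4" for a b
  proof -
    let ?A = "submatrix (A_mat 4 E) UNIV {a, b}" and ?B = "submatrix (B_mat 4 E) UNIV {a, b}"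
    have Jn: "{j. j < 4 \<and> (j = a \<or> j = b)} = {a, b}" using that by auto
    have c: "?A \<in> carrier_mat 2 2" "?B \<in> carrier_mat 2 2"
      using that by (auto simp: dim_submatrix A_mat_def B_mat_def Jn E_def)
    have e: "?A $$ (s, 0) = A_mat 4 E $$ (0, a)" "?A $$ (s, Suc 0) = A_mat 4 E $$ (0, b)"
      "?B $$ (s, 0) = B_mat 4 E $$ (0, a)" "?B $$ (s, Suc 0) = B_mat 4 E $$ (0, b)"
      if "s < 2" for s
      using that \<open>a < b\<close> \<open>b < 4\<close>
      by (auto simp: less_2_cases_iff submatrix_def A_mat_def B_mat_def E_def Jn pick_UNIV pick_pair
          simp del: pick.simps)
    have sg: "signof (transpose 0 (Suc 0)) = (-1 :: complex)" "signof id = (1::complex)"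
      by (simp_all add: sign_swap_id)
    have nid: "id \<noteq> transpose 0 (Suc 0)" "transpose 0 (Suc 0) \<noteq> id"
      by (metis id_apply transpose_apply_first zero_neq_one One_nat_def)+
    have l2: "{..<2::nat} = {0, Suc 0}" by auto
    show ?thesis
      unfolding sdet_expand[OF c] permutes_2
      by (simp add: sg e nid l2 transpose_def) (simp add: power2_eq_square algebra_simps)
  qed
  have "Phi 4 2 (eta_tensor E) = (\<Sum>J | J \<subseteq> {..<4} \<and> card J = 2.
             sdet (submatrix (A_mat 4 E) UNIV J) (submatrix (B_mat 4 E) UNIV J))"
  proof -
    have "length E = 2" "set E \<subseteq> quads 4" by (auto simp: quads_def E_def)
    then show ?thesis using is_Phi_Phi[of 4 2] unfolding is_Phi_def by blast
  qed
  also have "\<dots> = -8"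
    unfolding pairs
    by (simp add: sd doubleton_eq_iff) (simp add: A_mat_def B_mat_def E_def)
  finally show ?thesis by (simp add: numeral_2_eq_2 E_def)
qed

lemma factor_needed:
  fixes m :: "nat \<Rightarrow> complex"
  assumes "char_poly (rep_mat 4 (eta 0 1 2 3)) = monom 1 4 + (\<Sum>r = 1..4 - 1. monom (m r) (4 - r))"
  shows "m 2 = -4"
proof -
  define M where "M = rep_mat 4 (eta 0 1 2 3)"
  have q: "(0, 1, 2, 3) \<in> quads 4" by (auto simp: quads_def)
  have ent: "M $$ (a, b) = - ((if a = 0 then 1 else if a = 1 then -1 else 0) * (if b = 2 then 1 else if b = 3 then -1 else 0)
     + (if a = 2 then 1 else if a = 3 then -1 else 0) * (if b = 0 then 1 else if b = 1 then -1 else 0))"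
    if "a < 4" "b < 4" for a b
    using that rep_eta[OF q that] by (simp add: M_def rep_mat_def)
  have c: "M \<in> carrier_mat 4 4" by (simp add: M_def rep_mat_def)
  have r4: "{0..<4::nat} = {0, 1, 2, 3}" by auto
  have a4: "a < 4 \<Longrightarrow> a = 0 \<or> a = 1 \<or> a = 2 \<or> a = 3" for a :: nat by linarith
  have ev: "eigenvalue M k" if k: "k = 2 \<or> k = -2" for k
  proof -
    let ?v = "vec 4 (\<lambda>a. if a = 0 then 1 else if a = 1 then -1 else if a = 2 then -k/2 else k/2) :: complex vec"
    have "M *\<^sub>v ?v = k \<cdot>\<^sub>v ?v"
    proof (rule eq_vecI)
      fix a assume "a < dim_vec (k \<cdot>\<^sub>v ?v)"
      then have a: "a < 4" by simp
      have "(M *\<^sub>v ?v) $ a = (\<Sum>b\<in>{0, 1, 2, 3}. M $$ (a, b) * ?v $ b)"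
        using a c by (simp add: scalar_prod_def r4)
      also have "\<dots> = (k \<cdot>\<^sub>v ?v) $ a"
        using a4[OF a] by (elim disjE) (use k in \<open>auto simp: ent\<close>)
      finally show "(M *\<^sub>v ?v) $ a = (k \<cdot>\<^sub>v ?v) $ a" .
    qed (use c in simp)
    moreover have "?v \<noteq> 0\<^sub>v 4"
    proof
      assume "?v = 0\<^sub>v 4"
      then have "?v $ 0 = 0\<^sub>v 4 $ 0" by simp
      then show False by simp
    qed
    ultimately show ?thesis using c unfolding eigenvalue_def eigenvector_def
      by (intro exI[of _ ?v]) auto
  qed
  have *: "{1..4 - 1::nat} = {1, 2, 3}" by auto
  have "poly (char_poly M) 2 = 0" "poly (char_poly M) (-2) = 0"
    using ev eigenvalue_root_char_poly[OF c] by auto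
  then have "16 + 8 * m 1 + 4 * m 2 + 2 * m 3 = 0" "16 - 8 * m 1 + 4 * m 2 - 2 * m 3 = 0"
    unfolding M_def assms * by (simp_all add: poly_monom algebra_simps)
  then have "(16 + 8 * m 1 + 4 * m 2 + 2 * m 3) + (16 - 8 * m 1 + 4 * m 2 - 2 * m 3) = 0" by simp
  then have "8 * (m 2 + 4) = 0" by (simp add: algebra_simps)
  then show ?thesis by (simp add: add_eq_0_iff2)
qed

lemma unnormalised_formula_fails:
  "char_poly (rep_mat 4 (eta 0 1 2 3)) \<noteq>
     monom 1 4 + (\<Sum>r = 1..4 - 1. monom (Phi 4 r (tensor_power r (eta 0 1 2 3))) (4 - r))"
  using factor_needed[of "\<lambda>r. Phi 4 r (tensor_power r (eta 0 1 2 3))"] Phi_square_eta by auto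

end

theory Submission
  imports Defs
begin

text \<open>
  The coefficient of \<open>t\<^sup>n\<^sup>-\<^sup>r\<close> in \<open>det (t - M)\<close> is the sum of the \<open>r \<times> r\<close> principal minors of
  \<open>- M\<close>. The map \<open>\<eta>\<^sub>i\<^sub>j\<^sub>k\<^sub>l\<close> acts on \<open>\<complex>\<^sup>n\<close> as \<open>- (a b\<^sup>T + b a\<^sup>T)\<close>, where \<open>a\<close> and \<open>b\<close> are the rows of
  the matrices \<open>A\<close> and \<open>B\<close>. Expanding the shuffle determinant over pairs of permutations
  therefore shows that \<open>\<Phi>\<^sub>r\<close> is the restriction of a functional defined on the whole tensor power
  (the functional \<open>Phi0\<close>), whose value at \<open>x \<otimes> \<dots> \<otimes> x\<close> is a signed sum over pairs \<open>(\<sigma>, \<tau>)\<close> of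
  permutations in which only \<open>\<tau> \<circ> \<sigma>\<^sup>-\<^sup>1\<close> matters: this is \<open>r!\<close> times the sum of the principal minors.
  The constant coefficient vanishes because each \<open>\<eta>\<^sub>i\<^sub>j\<^sub>k\<^sub>l\<close> annihilates the vector of ones.
\<close>

section \<open>Determinants over finite index sets and principal minors\<close>

text \<open>The Leibniz formula with rows and columns labelled by \<open>J\<close> itself, so that a
  principal minor is \<open>det_on J\<close> of the full array of entries, without
  renumbering.\<close>

definition det_on :: "nat set \<Rightarrow> (nat \<Rightarrow> nat \<Rightarrow> 'a::comm_ring_1) \<Rightarrow> 'a" where
  "det_on J N = (\<Sum>p | p permutes J. signof p * (\<Prod>i\<in>J. N i (p i)))"

lemma det_eq_det_on:
  assumes "A \<in> carrier_mat n n"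
  shows "det A = det_on {..<n} (\<lambda>i j. A $$ (i, j))"
  unfolding det_def'[OF assms] det_on_def atLeast0LessThan ..

text \<open>Conjugation by \<open>f\<close> carries permutations of \<open>A\<close> to permutations
  of \<open>B\<close> and preserves the sign.\<close>

lemma det_on_reindex:
  assumes f: "bij_betw f A B" and fin: "finite A"
  shows "det_on A (\<lambda>i j. N (f i) (f j)) = det_on B N"
proof -
  have inj: "inj_on f A" using f by (rule bij_betw_imp_inj_on)
  have eq: "(\<lambda>x. if x \<in> B then f (p (inv_into A f x)) else x) = map_permutation A f p" for p
    using f by (auto simp: map_permutation_def restrict_id_def bij_betw_def fun_eq_iff)
  have bij: "bij_betw (map_permutation A f) {p. p permutes A} {p. p permutes B}"
    using bij_betw_permutations[OF f] unfolding eq .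
  have "det_on B N = (\<Sum>p | p permutes A. signof (map_permutation A f p) *
      (\<Prod>i\<in>B. N i (map_permutation A f p i)))"
    unfolding det_on_def by (rule sum.reindex_bij_betw[OF bij, symmetric])
  also have "\<dots> = (\<Sum>p | p permutes A. signof p * (\<Prod>i\<in>A. N (f i) (f (p i))))"
  proof (rule sum.cong[OF refl])
    fix p assume "p \<in> {p. p permutes A}"
    then have p: "p permutes A" by simp
    have "(\<Prod>i\<in>B. N i (map_permutation A f p i)) = (\<Prod>i\<in>A. N (f i) (map_permutation A f p (f i)))"
      by (rule prod.reindex_bij_betw[OF f, symmetric])
    also have "\<dots> = (\<Prod>i\<in>A. N (f i) (f (p i)))"
      by (rule prod.cong) (simp_all add: map_permutation_apply[OF inj])
    finally show "signof (map_permutation A f p) * (\<Prod>i\<in>B. N i (map_permutation A f p i)) =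
        signof p * (\<Prod>i\<in>A. N (f i) (f (p i)))"
      by (simp add: sign_map_permutation[OF inj p fin])
  qed
  finally show ?thesis unfolding det_on_def by simp
qed

text \<open>Substituting \<open>\<tau> \<circ> \<sigma>\<close> for \<open>\<tau>\<close> makes the
  sign of \<open>\<sigma>\<close> occur twice and cancel, and reindexing the product by
  \<open>\<sigma>\<close> removes \<open>\<sigma>\<close> altogether. The inner sum is thus the same
  for each of the \<open>fact (card S)\<close> choices of \<open>\<sigma>\<close>.\<close>

lemma sum_signof_signof_prod:
  fixes N :: "nat \<Rightarrow> nat \<Rightarrow> 'a::{comm_ring_1,semiring_char_0}"
  assumes fin: "finite S"
  shows "(\<Sum>\<sigma> | \<sigma> permutes S. \<Sum>\<tau> | \<tau> permutes S. signof \<sigma> * signof \<tau> * (\<Prod>s\<in>S. N (\<sigma> s) (\<tau> s)))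
       = fact (card S) * det_on S N"
proof -
  have "(\<Sum>\<tau> | \<tau> permutes S. signof \<sigma> * signof \<tau> * (\<Prod>s\<in>S. N (\<sigma> s) (\<tau> s))) = det_on S N"
    if \<sigma>: "\<sigma> permutes S" for \<sigma>
  proof -
    have "(\<Sum>\<tau> | \<tau> permutes S. signof \<sigma> * signof \<tau> * (\<Prod>s\<in>S. N (\<sigma> s) (\<tau> s)))
        = (\<Sum>\<tau> | \<tau> permutes S. signof \<sigma> * signof (\<tau> \<circ> \<sigma>) * (\<Prod>s\<in>S. N (\<sigma> s) ((\<tau> \<circ> \<sigma>) s)))"
      by (rule sum_permutations_compose_right[OF \<sigma>])
    also have "\<dots> = det_on S N"
      unfolding det_on_def
    proof (rule sum.cong[OF refl])
      fix \<tau> assume "\<tau> \<in> {\<tau>. \<tau> permutes S}"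
      then have \<tau>: "\<tau> permutes S" by simp
      have "(\<Prod>s\<in>S. N (\<sigma> s) ((\<tau> \<circ> \<sigma>) s)) = (\<Prod>s\<in>S. N s (\<tau> s))"
        unfolding o_def
        by (rule prod.reindex_bij_betw[OF permutes_imp_bij[OF \<sigma>], of "\<lambda>s. N s (\<tau> s)"])
      moreover have "sign (\<tau> \<circ> \<sigma>) = sign \<tau> * sign \<sigma>"
        using \<sigma> \<tau> fin by (intro sign_compose) (auto simp: permutation_permutes)
      moreover have "of_int (sign \<sigma>) * of_int (sign \<sigma>) = (1 :: 'a)"
        by (simp flip: of_int_mult)
      ultimately show "signof \<sigma> * signof (\<tau> \<circ> \<sigma>) * (\<Prod>s\<in>S. N (\<sigma> s) ((\<tau> \<circ> \<sigma>) s)) =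
          signof \<tau> * (\<Prod>s\<in>S. N s (\<tau> s))"
        by (simp add: mult_ac) (simp flip: mult.assoc)
    qed
    finally show ?thesis .
  qed
  then show ?thesis
    using card_permutations[OF refl fin] by simp
qed

text \<open>When each Leibniz product is multiplied out, \<open>J\<close> collects the rows that
  contribute an entry of \<open>N\<close>. The other rows contribute diagonal terms, whose product
  can be nonzero only if the permutation fixes all of \<open>S - J\<close>.\<close>

lemma det_on_add_diagonal:
  assumes fin: "finite S"
  shows "det_on S (\<lambda>i j. N i j + (if i = j then t else 0)) =
    (\<Sum>J\<in>Pow S. det_on J N * t ^ card (S - J))"
proof -
  have D: "(\<Prod>i\<in>S - J. if i = p i then t else 0) = (if p permutes J then t ^ card (S - J) else 0)"
    if J: "J \<subseteq> S" and p: "p permutes S" for J p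
  proof (cases "p permutes J")
    case True
    then have "(\<Prod>i\<in>S - J. if i = p i then t else 0) = (\<Prod>i\<in>S - J. t)"
      by (intro prod.cong) (auto simp: permutes_not_in)
    then show ?thesis using True by simp
  next
    case False
    then obtain i where "i \<in> S - J" "p i \<noteq> i"
      using permutes_superset[OF p, of J] by blast
    then have "(\<Prod>i\<in>S - J. if i = p i then t else 0) = 0"
      using fin by (intro prod_zero bexI[of _ i]) auto
    then show ?thesis using False by simp
  qed
  have "det_on S (\<lambda>i j. N i j + (if i = j then t else 0)) =
      (\<Sum>p | p permutes S. \<Sum>J\<in>Pow S. signof p * (\<Prod>i\<in>J. N i (p i)) *
         (\<Prod>i\<in>S - J. if i = p i then t else 0))"
    unfolding det_on_def prod_add[OF fin] by (simp add: sum_distrib_left mult.assoc)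
  also have "\<dots> = (\<Sum>J\<in>Pow S. \<Sum>p | p permutes S. signof p * (\<Prod>i\<in>J. N i (p i)) *
         (\<Prod>i\<in>S - J. if i = p i then t else 0))"
    by (rule sum.swap)
  also have "\<dots> = (\<Sum>J\<in>Pow S. det_on J N * t ^ card (S - J))"
  proof (rule sum.cong[OF refl])
    fix J assume "J \<in> Pow S"
    then have J: "J \<subseteq> S" by simp
    have "(\<Sum>p | p permutes S. signof p * (\<Prod>i\<in>J. N i (p i)) * (\<Prod>i\<in>S - J. if i = p i then t else 0))
        = (\<Sum>p | p permutes S. if p permutes J then signof p * (\<Prod>i\<in>J. N i (p i)) * t ^ card (S - J) else 0)"
      by (rule sum.cong) (auto simp: D[OF J])
    also have "\<dots> = (\<Sum>p | p permutes J. signof p * (\<Prod>i\<in>J. N i (p i)) * t ^ card (S - J))"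
      using fin J
      by (intro sum.mono_neutral_cong_right) (auto intro: permutes_subset finite_permutations)
    finally show "(\<Sum>p | p permutes S. signof p * (\<Prod>i\<in>J. N i (p i)) * (\<Prod>i\<in>S - J. if i = p i then t else 0))
        = det_on J N * t ^ card (S - J)"
      by (simp add: det_on_def sum_distrib_right)
  qed
  finally show ?thesis .
qed

lemma char_poly_principal_minors:
  fixes M :: "'a::field_char_0 mat"
  assumes M: "M \<in> carrier_mat n n"
  shows "char_poly M = (\<Sum>r\<le>n. monom
    (\<Sum>J | J \<subseteq> {..<n} \<and> card J = r. det_on J (\<lambda>i j. - M $$ (i, j))) (n - r))"
\<comment> \<open>Over an infinite field it suffices to compare values at every
  \<open>t\<close>.\<close>
proof (rule poly_eq_poly_eq_iff[THEN iffD1], rule ext)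
  fix t :: 'a
  let ?N = "\<lambda>i j. - M $$ (i, j)"
  have "poly (char_poly M) t = det (- char_matrix M t)"
    by (rule char_poly_matrix[OF M])
  also have "\<dots> = det_on {..<n} (\<lambda>i j. (- char_matrix M t) $$ (i, j))"
    using M by (intro det_eq_det_on) auto
  also have "\<dots> = det_on {..<n} (\<lambda>i j. ?N i j + (if i = j then t else 0))"
    unfolding det_on_def
  proof (intro sum.cong refl arg_cong2[where f = "(*)"] prod.cong)
    fix p i assume "p \<in> {p. p permutes {..<n}}" "i \<in> {..<n}"
    then have "i < n" "p i < n" using permutes_in_image[of p "{..<n}" i] by auto
    then show "(- char_matrix M t) $$ (i, p i) = ?N i (p i) + (if i = p i then t else 0)"
      using M by (auto simp: char_matrix_def)
  qed
  also have "\<dots> = (\<Sum>J\<in>Pow {..<n}. det_on J ?N * t ^ card ({..<n} - J))"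
    by (rule det_on_add_diagonal) simp
  also have "\<dots> = (\<Sum>J\<in>Pow {..<n}. det_on J ?N * t ^ (n - card J))"
    by (rule sum.cong) (auto simp: card_Diff_subset finite_subset)
  also have "\<dots> = (\<Sum>r\<le>n. \<Sum>J | J \<in> Pow {..<n} \<and> card J = r. det_on J ?N * t ^ (n - card J))"
  proof (rule sum.group[symmetric])
    show "card ` Pow {..<n} \<subseteq> {..n}"
      using card_mono[of "{..<n}"] by force
  qed auto
  also have "\<dots> = poly (\<Sum>r\<le>n. monom (\<Sum>J | J \<subseteq> {..<n} \<and> card J = r. det_on J ?N) (n - r)) t"
    by (simp add: poly_sum poly_monom sum_distrib_right)
  finally show "poly (char_poly M) t =
      poly (\<Sum>r\<le>n. monom (\<Sum>J | J \<subseteq> {..<n} \<and> card J = r. det_on J ?N) (n - r)) t" .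
qed

section \<open>Evaluation of \<open>Phi0\<close> on tensor powers\<close>

lemma bij_betw_pick:
  assumes "finite J"
  shows "bij_betw (pick J) {..<card J} J"
proof -
  \<comment> \<open>\<open>pick J\<close> is strictly increasing below \<open>card J\<close>;
    surjectivity then follows by counting.\<close>
  have "inj_on (pick J) {..<card J}"
    using pick_mono_le[of _ J] by (intro inj_onI) (metis lessThan_iff nat_neq_iff)
  moreover have "pick J ` {..<card J} \<subseteq> J"
    using pick_in_set_le by auto
  ultimately show ?thesis
    using assms by (simp add: bij_betw_def card_image card_subset_eq)
qed

text \<open>The same matrix stands in every tensor slot, so for fixed \<open>J\<close> the double
  sum over permutations is the one of \<open>sum_signof_signof_prod\<close>. This is the source of
  \<open>fact r\<close>.\<close>

lemma Phi0_tensor_power: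
  "Phi0 n r (tensor_power r x) = fact r *
     (\<Sum>J | J \<subseteq> {..<n} \<and> card J = r. det_on J (\<lambda>i j. - rep_mat n x $$ (i, j)))"
proof -
  let ?N = "\<lambda>i j. - rep_mat n x $$ (i, j)"
  let ?P = "{p. p permutes {..<n}}"
  have "(\<Sum>\<sigma> | \<sigma> permutes {..<r}. \<Sum>\<tau> | \<tau> permutes {..<r}. signof \<sigma> * signof \<tau> *
       (\<Sum>gs | set gs \<subseteq> ?P \<and> length gs = r.
          tensor_power r x gs * (\<Prod>s<r. - perm_mat n (gs ! s) $$ (pick J (\<sigma> s), pick J (\<tau> s)))))
     = fact r * det_on J ?N" if J: "J \<subseteq> {..<n}" and r: "card J = r" for J
  proof -
    have bij: "bij_betw (pick J) {..<r} J"
      using bij_betw_pick[of J] J r finite_subset by blast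
    have pn: "pick J s < n" if "s < r" for s
      using that bij J by (auto dest: bij_betwE)
    have "(\<Sum>gs | set gs \<subseteq> ?P \<and> length gs = r.
          tensor_power r x gs * (\<Prod>s<r. - perm_mat n (gs ! s) $$ (pick J (\<sigma> s), pick J (\<tau> s))))
        = (\<Prod>s<r. ?N (pick J (\<sigma> s)) (pick J (\<tau> s)))"
      if \<sigma>: "\<sigma> permutes {..<r}" and \<tau>: "\<tau> permutes {..<r}" for \<sigma> \<tau>
    proof -
      let ?f = "\<lambda>s g. - perm_mat n g $$ (pick J (\<sigma> s), pick J (\<tau> s))"
      let ?xs = "replicate r x"
      \<comment> \<open>A pure tensor takes product values, so the sum over lists factors into one
        sum per position, each an entry of \<open>- rep_mat n x\<close>.\<close>
      have "(\<Sum>gs | set gs \<subseteq> ?P \<and> length gs = r. tensor_power r x gs * (\<Prod>s<r. ?f s (gs ! s)))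
          = (\<Sum>gs | set gs \<subseteq> ?P \<and> length gs = length ?xs.
               \<Prod>s<length ?xs. (?xs ! s) (gs ! s) * ?f s (gs ! s))"
        by (intro sum.cong) (auto simp: tensor_def prod.distrib simp del: mult_minus_right)
      also have "\<dots> = (\<Prod>s<length ?xs. \<Sum>g\<in>?P. (?xs ! s) g * ?f s g)"
        by (rule sum_lists_prod) (simp add: finite_permutations)
      also have "\<dots> = (\<Prod>s<r. ?N (pick J (\<sigma> s)) (pick J (\<tau> s)))"
      proof (rule prod.cong)
        fix s assume "s \<in> {..<r}"
        then have s: "s < r" "\<sigma> s < r" "\<tau> s < r"
          using permutes_in_image[OF \<sigma>, of s] permutes_in_image[OF \<tau>, of s] by simp_all
        then show "(\<Sum>g\<in>?P. (?xs ! s) g * ?f s g) = ?N (pick J (\<sigma> s)) (pick J (\<tau> s))"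
          using pn by (simp add: rep_mat_def sum_negf)
      qed simp
      finally show ?thesis .
    qed
    then have "(\<Sum>\<sigma> | \<sigma> permutes {..<r}. \<Sum>\<tau> | \<tau> permutes {..<r}. signof \<sigma> * signof \<tau> *
       (\<Sum>gs | set gs \<subseteq> ?P \<and> length gs = r.
          tensor_power r x gs * (\<Prod>s<r. - perm_mat n (gs ! s) $$ (pick J (\<sigma> s), pick J (\<tau> s)))))
      = (\<Sum>\<sigma> | \<sigma> permutes {..<r}. \<Sum>\<tau> | \<tau> permutes {..<r}. signof \<sigma> * signof \<tau> *
          (\<Prod>s<r. ?N (pick J (\<sigma> s)) (pick J (\<tau> s))))"
      by (intro sum.cong refl) simp
    also have "\<dots> = fact r * det_on {..<r} (\<lambda>a b. ?N (pick J a) (pick J b))"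
      using sum_signof_signof_prod[of "{..<r}" "\<lambda>a b. ?N (pick J a) (pick J b)"] by simp
    also have "\<dots> = fact r * det_on J ?N"
      by (rule arg_cong[OF det_on_reindex[OF bij finite_lessThan]])
    finally show ?thesis .
  qed
  then show ?thesis
    unfolding Phi0_def sum_distrib_left by (intro sum.cong) auto
qed

section \<open>Tensor powers in the domain of \<open>Phi\<close>\<close>

text \<open>Splits off the first tensor factor, linearly in each argument, for induction on the
  number of factors. The value at \<open>[]\<close> is 0 because at least one factor is
  present.\<close>

definition tensor_Cons :: "grp_alg \<Rightarrow> tensor \<Rightarrow> tensor" where
  "tensor_Cons x T = (\<lambda>gs. case gs of [] \<Rightarrow> 0 | g # gs' \<Rightarrow> x g * T gs')"

lemma tensor_Cons: "tensor (x # xs) = tensor_Cons x (tensor xs)"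
  by (auto simp: tensor_def tensor_Cons_def fun_eq_iff prod.lessThan_Suc_shift
      simp del: prod.lessThan_Suc split: list.split)

lemma tensor_Cons_linear:
  "tensor_Cons (c *\<^sub>c x + y) T = c *\<^sub>c tensor_Cons x T + tensor_Cons y T"
  "tensor_Cons x (c *\<^sub>c S + T) = c *\<^sub>c tensor_Cons x S + tensor_Cons x T"
  "tensor_Cons 0 T = 0" "tensor_Cons x 0 = 0"
  by (auto simp: tensor_Cons_def cscale_def fun_eq_iff algebra_simps split: list.split)

text \<open>Membership in this span serves twice: it places tensor powers in
  \<open>H_tensor\<close>, and it forces row sums to vanish.\<close>

abbreviation eta_span :: "nat \<Rightarrow> grp_alg set" where
  "eta_span n \<equiv> cfun.span {eta i j k l |i j k l. (i, j, k, l) \<in> quads n}"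

text \<open>By bilinearity, two nested span inductions reduce the claim to one \<open>eta\<close>
  prepended to an \<open>eta_tensor E\<close>, which is again a generator.\<close>

lemma tensor_Cons_in_H_tensor:
  assumes x: "x \<in> eta_span n" and T: "T \<in> H_tensor n r"
  shows "tensor_Cons x T \<in> H_tensor n (Suc r)"
  using x
proof (induction rule: cfun.span_induct_alt)
  case base
  show ?case unfolding tensor_Cons_linear H_tensor_def by (rule cfun.span_zero)
next
  case (step c x y)
  then obtain i j k l where x: "x = eta i j k l" and q: "(i, j, k, l) \<in> quads n" by blast
  from T have "tensor_Cons x T \<in> H_tensor n (Suc r)"
    unfolding H_tensor_def[of n r]
  proof (induction rule: cfun.span_induct_alt)
    case base
    show ?case unfolding tensor_Cons_linear H_tensor_def by (rule cfun.span_zero)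
  next
    case (step c S T)
    then obtain E where E: "S = eta_tensor E" "length E = r" "set E \<subseteq> quads n" by blast
    have "tensor_Cons x S = eta_tensor ((i, j, k, l) # E)"
      by (simp add: tensor_Cons E x)
    also have "\<dots> \<in> H_tensor n (Suc r)"
      using E q by (intro eta_tensor_in) auto
    finally show ?case
      using step unfolding tensor_Cons_linear H_tensor_def
      by (intro cfun.span_add cfun.span_scale) auto
  qed
  then show ?case
    using step unfolding tensor_Cons_linear H_tensor_def
    by (intro cfun.span_add cfun.span_scale) auto
qed

lemma tensor_power_in_H_tensor:
  assumes "x \<in> eta_span n"
  shows "tensor_power r x \<in> H_tensor n r"
proof (induction r)
  case 0
  have "eta_tensor [] \<in> H_tensor n 0" by (rule eta_tensor_in) auto
  then show ?case by simp
next
  case (Suc r)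
  then show ?case using tensor_Cons_in_H_tensor[OF assms] by (simp add: tensor_Cons)
qed

text \<open>\<open>Phi\<close> is chosen by \<open>SOME\<close> and is known to agree with
  \<open>Phi0\<close> only on \<open>H_tensor\<close>, hence the detour through membership of the
  tensor power.\<close>

lemma Phi_tensor_power:
  assumes "x \<in> eta_span n"
  shows "Phi n r (tensor_power r x) = fact r *
     (\<Sum>J | J \<subseteq> {..<n} \<and> card J = r. det_on J (\<lambda>i j. - rep_mat n x $$ (i, j)))"
  using Phi_unique[OF is_Phi_Phi is_Phi_Phi0 tensor_power_in_H_tensor[OF assms]]
  unfolding Phi0_tensor_power .

section \<open>Vanishing of the constant coefficient\<close>

text \<open>By \<open>rep_eta\<close>, each row of the matrix of an \<open>eta\<close> is a
  combination of two vectors with one entry 1, one entry -1 and zeros elsewhere.\<close>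

lemma rep_mat_row_sum:
  assumes x: "x \<in> eta_span n" and a: "a < n"
  shows "(\<Sum>b<n. rep_mat n x $$ (a, b)) = 0"
proof -
  let ?R = "\<lambda>x. \<Sum>b<n. \<Sum>p | p permutes {..<n}. x p * perm_mat n p $$ (a, b)"
  from x have "?R x = 0"
  proof (induction rule: cfun.span_induct_alt)
    case base
    show ?case by simp
  next
    case (step c x y)
    then obtain i j k l where x: "x = eta i j k l" and q: "(i, j, k, l) \<in> quads n" by blast
    have z: "(\<Sum>b<n. if b = u then 1 else if b = v then -1 else 0 :: complex) = 0"
      if "u < n" "v < n" "u \<noteq> v" for u v
    proof -
      have "(\<Sum>b<n. if b = u then 1 else if b = v then -1 else 0 :: complex)
          = (\<Sum>b<n. (if b = u then 1 else 0) - (if b = v then 1 else 0))"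
        using that by (intro sum.cong) auto
      then show ?thesis using that by (simp add: sum_subtractf)
    qed
    have "?R x = 0"
      unfolding x using q
      by (simp add: rep_eta[OF q a] sum_negf sum.distrib z quads_def flip: sum_distrib_left
          del: mult_minus1 mult_minus_left)
    moreover have "?R (c *\<^sub>c x + y) = c * ?R x + ?R y"
      by (simp add: cscale_def distrib_right sum.distrib sum_distrib_left mult.assoc)
    ultimately show ?case using step by simp
  qed
  then show ?thesis using a by (simp add: rep_mat_def)
qed

lemma det_rep_mat_eq_0:
  assumes x: "x \<in> eta_span n" and n: "n > 0"
  shows "det (- rep_mat n x) = 0"
proof -
  have c: "- rep_mat n x \<in> carrier_mat n n" by (simp add: rep_mat_def)
  let ?v = "vec n (\<lambda>_. 1) :: complex vec"
  have "?v \<noteq> 0\<^sub>v n"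
  proof
    assume "?v = 0\<^sub>v n"
    then have "?v $ 0 = 0\<^sub>v n $ 0" by simp
    then show False using n by simp
  qed
  moreover have "- rep_mat n x *\<^sub>v ?v = 0\<^sub>v n"
  proof (rule eq_vecI)
    fix a assume "a < dim_vec (0\<^sub>v n :: complex vec)"
    then have a: "a < n" by simp
    then have "(- rep_mat n x *\<^sub>v ?v) $ a = - (\<Sum>b<n. rep_mat n x $$ (a, b))"
      using c by (simp add: scalar_prod_def sum_negf atLeast0LessThan)
    then show "(- rep_mat n x *\<^sub>v ?v) $ a = 0\<^sub>v n $ a"
      using rep_mat_row_sum[OF x a] a by simp
  qed (use c in simp)
  ultimately show ?thesis
    unfolding det_0_iff_vec_prod_zero_field[OF c] by (intro exI[of _ ?v]) simp
qed

section \<open>Assembly of the characteristic polynomial\<close>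

lemma char_poly_eta_span:
  assumes z: "z \<in> eta_span n"
  shows "char_poly (rep_mat n z) =
    monom 1 n + (\<Sum>r = 1..n - 1. monom (Phi n r (tensor_power r z) / fact r) (n - r))"
proof -
  let ?M = "rep_mat n z"
  define c where "c r = (\<Sum>J | J \<subseteq> {..<n} \<and> card J = r. det_on J (\<lambda>i j. - ?M $$ (i, j)))" for r
  have M: "?M \<in> carrier_mat n n" by (simp add: rep_mat_def)
  have "{J. J \<subseteq> {..<n} \<and> card J = 0} = {{}}"
    using finite_subset[OF _ finite_lessThan[of n]] by auto
  then have c0: "c 0 = 1"
    by (simp add: c_def det_on_def)
  have cn: "c n = 0" if "n > 0"
  proof -
    have "{J. J \<subseteq> {..<n} \<and> card J = n} = {{..<n}}"
      using card_subset_eq[of "{..<n}"] by auto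
    then have "c n = det_on {..<n} (\<lambda>i j. - ?M $$ (i, j))"
      by (simp add: c_def)
    also have "\<dots> = det (- ?M)"
      unfolding det_eq_det_on[OF uminus_carrier_mat[OF M]] det_on_def
    proof (intro sum.cong refl arg_cong2[where f = "(*)"] prod.cong)
      fix p i assume "p \<in> {p. p permutes {..<n}}" "i \<in> {..<n}"
      then have "i < n" "p i < n" using permutes_in_image[of p "{..<n}" i] by auto
      then show "- ?M $$ (i, p i) = (- ?M) $$ (i, p i)" using M by simp
    qed
    finally show ?thesis using det_rep_mat_eq_0[OF z that] by simp
  qed
  have "char_poly ?M = (\<Sum>r\<le>n. monom (c r) (n - r))"
    unfolding c_def by (rule char_poly_principal_minors[OF M])
  also have "\<dots> = monom 1 n + (\<Sum>r = 1..n - 1. monom (c r) (n - r))"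
  \<comment> \<open>For \<open>n = 0\<close> both sides are 1, the range \<open>{1..0}\<close> being
    empty. Otherwise the term \<open>r = n\<close> vanishes and \<open>r = 0\<close> gives the
    leading monomial.\<close>
  proof (cases n)
    case (Suc m)
    have "(\<Sum>r\<le>n. monom (c r) (n - r)) = (\<Sum>r\<le>m. monom (c r) (n - r))"
      using Suc cn by simp
    also have "{..m} = insert 0 {1..n - 1}" using Suc by auto
    finally show ?thesis by (simp add: c0)
  qed (simp add: c0)
  \<comment> \<open>Division by \<open>fact r\<close> cancels the factor in
    \<open>Phi_tensor_power\<close> and leaves \<open>c r\<close>.\<close>
  finally show ?thesis
    using Phi_tensor_power[OF z] by (simp add: c_def)
qed

theorem theorem8:
  fixes n :: nat
    and \<xi> :: "nat \<Rightarrow> nat \<Rightarrow> nat \<Rightarrow> nat \<Rightarrow> grp_alg"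
    and z :: grp_alg
  assumes "\<And>i j k l. i < j \<Longrightarrow> j < k \<Longrightarrow> k < l \<Longrightarrow> l < n \<Longrightarrow> \<xi> i j k l \<in> H_space i j k l"
    and "z = (\<Sum>(i, j, k, l) | i < j \<and> j < k \<and> k < l \<and> l < n. \<xi> i j k l)"
  shows "char_poly (rep_mat n z) =
           monom 1 n + (\<Sum>r = 1..n - 1. monom (Phi n r (tensor_power r z) / fact r) (n - r))"
proof (rule char_poly_eta_span)
  \<comment> \<open>\<open>quads n\<close> admits its indices in any order, so the generators of
    \<open>H_space i j k l\<close> are among those of \<open>eta_span n\<close>.\<close>
  have "\<xi> i j k l \<in> eta_span n" if "i < j" "j < k" "k < l" "l < n" for i j k l
  proof -
    have "{i, j, k, l} \<subseteq> {..<n}" using that by auto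
    then have "{eta p q r s |p q r s. distinct [p, q, r, s] \<and> {p, q, r, s} = {i, j, k, l}}
        \<subseteq> {eta p q r s |p q r s. (p, q, r, s) \<in> quads n}"
      unfolding quads_def by blast
    then show ?thesis
      using assms(1)[OF that] cfun.span_mono unfolding H_space_def by blast
  qed
  then show "z \<in> eta_span n"
    unfolding assms(2) by (intro cfun.span_sum) auto
qed

end
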